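(* Let $\mathcal P$ be either the class $\mathcal P_{\mathrm{low}}$ or the class $\mathcal P_{\mathrm{high}}$ of predicates. Then there exists a negligible function $\delta(M)$ such that, for every analyst (adversary) $\mathcal A$, every distribution $\mathcal D$ over $[N]$ and all $M,T\ge1$, $\epsilon\in(0,1)$, $\lambda\in(0,1]$, the success probability of $\mathcal A$ in the predicate singling out game against the mechanism $\mathcal M_{\mathrm{AQA\text{-}OGD}}$ (run with accuracy $\epsilon$ and density $\lambda$, and any failure-probability parameter $\delta_0\in(0,1)$) satisfies $$\mathrm{Succ}^{\mathcal A,\,\mathcal M_{\mathrm{AQA\text{-}OGD}}}_{\mathcal P,\mathcal D}(M,T)\ \le\ \epsilon^{-1}\,T^{128/(\lambda\epsilon)^2}\,\delta(M).$$
   Context: Notation: $[N]=\{1,\dots,N\}$, $N=2^n$; $q(\mathcal D)=\mathbb E_{i\sim\mathcal D}[q(i)]$; for a multiset $S$ of size $M$, $q(S)=\frac1M\sum_{i\in S}q(i)$ (with multiplicity); $\mathrm{sign}(x)=1$ if $x\ge0$, $-1$ otherwise. A function $\nu(M)\ge0$ is negligible if $\nu(M)=o(M^{-c})$ for every $c\in\mathbb N$. Predicate singling out game with predicate class $\mathcal P\subseteq\{0,1\}^N$: a multiset $S$ of $M$ i.i.d. samples from $\mathcal D$ is given to the mechanism but not to the (possibly randomized, computationally unbounded, $\mathcal D$-aware) adversary $\mathcal A$; in each round $t=1,\dots,T$, $\mathcal A$ chooses $q_t\in\{-1,1\}^N$ given $(q_1,a_1,\dots,q_{t-1},a_{t-1})$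 and the mechanism outputs an answer $a_t$; finally $\mathcal A$ outputs a predicate $p:[N]\to\{0,1\}$. The predicate $p$ isolates a row in $S$, written $\mathrm{iso}(p,S)$, if exactly one entry of $S$ (counted with multiplicity) satisfies $p$, i.e. $p(S)=1/M$. The success probability is $\mathrm{Succ}^{\mathcal A,\mathcal M}_{\mathcal P,\mathcal D}(M,T)=\Pr[\mathrm{iso}(p,S)\text{ and }p\in\mathcal P]$, over the sample and all internal randomness. Predicate classes: $\mathcal P_{\mathrm{low}}=\{p\in\{0,1\}^N:\ p(\mathcal D)\in\mathrm{negl}(M)\}$ and $\mathcal P_{\mathrm{high}}=\{p\in\{0,1\}^N:\ p(\mathcal D)\in\omega(\log M/M)\}$, understood as follows: a weight function $w$ is fixed, negligible in the first case and with $w(M)=\omega(\log M/M)$ in the second, and for sample size $M$ the class consists of the predicates with $p(\mathcal D)\le w(M)$, respectively $p(\mathcal D)\ge w(M)$. (The function $\delta(M)$ in the claim may depend on $w$.) Subroutine $\mathrm{IP}_{\mathrm{est}}(q,\mathcal G;\eta,\rho)$, for $q\in\{-1,1\}^N$ and a finite multiset $\mathcal G$ of vectors in $\mathbb R^N$: draw fresh i.i.d. uniform $i_1,\dots,i_B\in[N]$ with $B=\lceil 0.5\,\eta^{-2}T^2\ln\frac{2T}{\rho}\rceil$ and return $\frac1B\sum_{v\in\mathcal G}\sum_{k=1}^B q(i_k)v(i_k)$. Mechanism $\mathcal M_{\mathrm{AQA\text{-}OGD}}$ with parameters $\epsilon,\delta_0,\lambda$: start with the empty multiset $\mathcal G$.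 In each round $t$, receive $q_t$ and compute $\hat u_t=\mathrm{IP}_{\mathrm{est}}(q_t,\mathcal G;\lambda\epsilon/8,\delta_0/(2T))$. If $|\hat u_t-\lambda q_t(S)|>\lambda\epsilon/2$ and $|\mathcal G|\le128(\lambda\epsilon)^{-2}$, then set $s_t=\mathrm{sign}(\hat u_t-\lambda q_t(S))$, add the vector $-\lambda\epsilon s_tq_t/16$ to $\mathcal G$, and let $a_t$ be $q_t(S)$ rounded to the nearest multiple of $\epsilon/2$. Otherwise let $a_t=\hat u_t/\lambda$. Send $a_t$ to $\mathcal A$. *)

theory Defs
  imports "HOL-Probability.Probability" "HOL-Library.Landau_Symbols"
begin

text \<open>
  The ground set of size \<open>2 ^ n\<close> is a set of natural numbers rather than a type, so that
  statements can quantify over \<open>n\<close> underneath other quantifiers.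
\<close>

definition domain_set :: "nat \<Rightarrow> nat set" where
  "domain_set n = {1..2 ^ n}"

text \<open>
  Elements of \<open>\<real>\<^sup>N\<close> are functions \<open>nat \<Rightarrow> real\<close>, of which only the values on
  \<^term>\<open>domain_set n\<close> matter. Queries and predicates are made extensional, so that they
  are in bijection with \<open>{-1, 1}\<^sup>N\<close> and \<open>{0, 1}\<^sup>N\<close>.
\<close>

type_synonym vec = "nat \<Rightarrow> real"

definition queries :: "nat \<Rightarrow> vec set" where
  "queries n = domain_set n \<rightarrow>\<^sub>E {-1, 1}"

definition predicates :: "nat \<Rightarrow> vec set" where
  "predicates n = domain_set n \<rightarrow>\<^sub>E {0, 1}"

definition pop_mean :: "vec \<Rightarrow> nat pmf \<Rightarrow> real" where
  "pop_mean q D = measure_pmf.expectation D q"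

definition sample_mean :: "vec \<Rightarrow> nat multiset \<Rightarrow> real" where
  "sample_mean q S = (\<Sum>i\<in>#S. q i) / real (size S)"

definition isolates :: "vec \<Rightarrow> nat multiset \<Rightarrow> bool" where
  "isolates p S \<longleftrightarrow> size {#i \<in># S. p i = 1#} = 1"

lemma isolates_iff_sample_mean:
  assumes "p \<in> predicates n" and "set_mset S \<subseteq> domain_set n" and "S \<noteq> {#}"
  shows "isolates p S \<longleftrightarrow> sample_mean p S = 1 / real (size S)"
proof -
  have "(\<Sum>i\<in>#S. p i) = real (size {#i \<in># S. p i = 1#})"
    using assms(2)
  proof (induction S)
    case (add x S)
    then have "p x \<in> {0, 1}"
      using assms(1) by (auto simp: predicates_def)
    then show ?case using add by auto
  qed simp
  then show ?thesis
    using assms(3) by (simp add: isolates_def sample_mean_def divide_simps)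
qed

text \<open>The library function \<^const>\<open>sgn\<close> differs from this one at 0.\<close>

definition sign_pm :: "real \<Rightarrow> real" where
  "sign_pm x = (if x \<ge> 0 then 1 else -1)"

definition negligible_fun :: "(nat \<Rightarrow> real) \<Rightarrow> bool" where
  "negligible_fun \<nu> \<longleftrightarrow>
     (\<forall>m. \<nu> m \<ge> 0) \<and> (\<forall>c::nat. \<nu> \<in> o(\<lambda>m. 1 / real m ^ c))"

text \<open>
  Nonnegativity is stated because \<open>\<omega>\<close> compares absolute values only.
\<close>

definition super_log_weight :: "(nat \<Rightarrow> real) \<Rightarrow> bool" where
  "super_log_weight w \<longleftrightarrow>
     (\<forall>m. w m \<ge> 0) \<and> w \<in> \<omega>(\<lambda>m. ln (real m) / real m)"

definition P_low :: "(nat \<Rightarrow> real) \<Rightarrow> nat \<Rightarrow> nat pmf \<Rightarrow> nat \<Rightarrow> vec set" where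
  "P_low w n D M = {p \<in> predicates n. pop_mean p D \<le> w M}"

definition P_high :: "(nat \<Rightarrow> real) \<Rightarrow> nat \<Rightarrow> nat pmf \<Rightarrow> nat \<Rightarrow> vec set" where
  "P_high w n D M = {p \<in> predicates n. pop_mean p D \<ge> w M}"

type_synonym transcript = "(vec \<times> real) list"

text \<open>
  Transcripts are in chronological order. \<open>coins\<close> is private randomness drawn once and kept
  through the whole game (a discrete distribution has countable support, so seeds in
  \<^typ>\<open>nat\<close> are general); in addition each move may use fresh randomness.
  A fixed seed type keeps the type of adversaries free of type variables, so that a bound can
  be chosen before the adversary.
\<close>

record adversary =
  coins :: "nat pmf"
  next_query :: "nat \<Rightarrow> transcript \<Rightarrow> vec pmf"
  output_pred :: "nat \<Rightarrow> transcript \<Rightarrow> vec pmf"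

definition adversary_on :: "nat \<Rightarrow> adversary \<Rightarrow> bool" where
  "adversary_on n A \<longleftrightarrow>
     (\<forall>r h. set_pmf (next_query A r h) \<subseteq> queries n \<and>
            set_pmf (output_pred A r h) \<subseteq> predicates n)"

text \<open>A mechanism answers from the sample, its current internal state and the query.\<close>

record 'st mechanism =
  init_state :: 'st
  answer :: "nat multiset \<Rightarrow> 'st \<Rightarrow> vec \<Rightarrow> (real \<times> 'st) pmf"

primrec interaction ::
  "(transcript \<Rightarrow> vec pmf) \<Rightarrow> 'st mechanism \<Rightarrow> nat multiset \<Rightarrow> nat \<Rightarrow> (transcript \<times> 'st) pmf"
where
  "interaction qs Mech S 0 = return_pmf ([], init_state Mech)"
| "interaction qs Mech S (Suc t) =
     do {
       (h, st) \<leftarrow> interaction qs Mech S t;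
       q \<leftarrow> qs h;
       (a, st') \<leftarrow> answer Mech S st q;
       return_pmf (h @ [(q, a)], st')
     }"

definition pso_game ::
  "adversary \<Rightarrow> 'st mechanism \<Rightarrow> nat pmf \<Rightarrow> nat \<Rightarrow> nat \<Rightarrow> (nat multiset \<times> vec) pmf"
where
  "pso_game A Mech D M T =
     do {
       S \<leftarrow> map_pmf mset (replicate_pmf M D);
       r \<leftarrow> coins A;
       (h, st) \<leftarrow> interaction (next_query A r) Mech S T;
       p \<leftarrow> output_pred A r h;
       return_pmf (S, p)
     }"

definition Succ ::
  "adversary \<Rightarrow> 'st mechanism \<Rightarrow> vec set \<Rightarrow> nat pmf \<Rightarrow> nat \<Rightarrow> nat \<Rightarrow> real"
where
  "Succ A Mech P D M T =
     measure_pmf.prob (pso_game A Mech D M T) {(S, p). isolates p S \<and> p \<in> P}"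

definition IP_sample_size :: "nat \<Rightarrow> real \<Rightarrow> real \<Rightarrow> nat" where
  "IP_sample_size T \<eta> \<rho> =
     nat \<lceil>1 / 2 * (1 / \<eta>\<^sup>2) * (real T)\<^sup>2 * ln (2 * real T / \<rho>)\<rceil>"

definition IP_est ::
  "nat \<Rightarrow> nat \<Rightarrow> vec \<Rightarrow> vec multiset \<Rightarrow> real \<Rightarrow> real \<Rightarrow> real pmf"
where
  "IP_est n T q G \<eta> \<rho> =
     (let B = IP_sample_size T \<eta> \<rho> in
      map_pmf (\<lambda>is. 1 / real B * (\<Sum>v\<in>#G. \<Sum>i\<leftarrow>is. q i * v i))
        (replicate_pmf B (pmf_of_set (domain_set n))))"

text \<open>Halfway cases are rounded up.\<close>

definition round_to_multiple :: "real \<Rightarrow> real \<Rightarrow> real" where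
  "round_to_multiple s x = s * of_int (round (x / s))"

text \<open>
  The state is the multiset of gradient vectors collected so far; \<open>lam\<close> is the density.
\<close>

definition AQA_OGD_answer ::
  "nat \<Rightarrow> nat \<Rightarrow> real \<Rightarrow> real \<Rightarrow> real \<Rightarrow> nat multiset \<Rightarrow> vec multiset \<Rightarrow> vec
     \<Rightarrow> (real \<times> vec multiset) pmf"
where
  "AQA_OGD_answer n T \<epsilon> \<delta>\<^sub>0 lam S G q =
     do {
       u \<leftarrow> IP_est n T q G (lam * \<epsilon> / 8) (\<delta>\<^sub>0 / (2 * real T));
       return_pmf
         (if \<bar>u - lam * sample_mean q S\<bar> > lam * \<epsilon> / 2 \<and>
             real (size G) \<le> 128 / (lam * \<epsilon>)\<^sup>2
          then (round_to_multiple (\<epsilon> / 2) (sample_mean q S),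
                let s = sign_pm (u - lam * sample_mean q S)
                in add_mset (\<lambda>i. - (lam * \<epsilon> * s * q i / 16)) G)
          else (u / lam, G))
     }"

definition AQA_OGD :: "nat \<Rightarrow> nat \<Rightarrow> real \<Rightarrow> real \<Rightarrow> real \<Rightarrow> vec multiset mechanism" where
  "AQA_OGD n T \<epsilon> \<delta>\<^sub>0 lam =
     \<lparr>init_state = {#}, answer = AQA_OGD_answer n T \<epsilon> \<delta>\<^sub>0 lam\<rparr>"

end

theory Submission
  imports Defs "HOL-Real_Asymp.Real_Asymp"
begin

text \<open>
  For a predicate \<open>p\<close> chosen without looking at \<open>S\<close>, the number of entries of \<open>S\<close> satisfying \<open>p\<close>
  is binomial, so the probability of isolating is \<open>M v (1 - v) ^ (M - 1)\<close> with \<open>v = p(D)\<close>; in both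
  classes this is at most some negligible \<open>\<nu>(M)\<close>. Given the mechanism's coins, an
  answer depends on \<open>S\<close> only through whether the round is an update and, if so, through one of at
  most \<open>12 / \<epsilon>\<close> possible outcomes. A union bound over the rounds and outcomes of
  the updates gives a success probability of at most \<open>N \<nu>(M)\<close>, with \<open>N\<close> the number of ways to
  place and answer them.

  The cap allows up to \<open>\<lfloor>x\<rfloor> + 1\<close> updates with \<open>x = 128 / (\<lambda>\<epsilon>)\<^sup>2\<close>, and each costs a factor
  \<open>O(T / \<epsilon>)\<close>, so \<open>N\<close> itself may exceed \<open>T powr x / \<epsilon>\<close>. But \<open>N \<le> 16 / \<epsilon> * T powr (4 x)\<close>, and as
  probabilities are at most 1, the success probability is at most the fourth root of \<open>N \<nu>(M)\<close>;
  hence \<open>\<delta> = 2 \<nu> powr (1/4)\<close>.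
\<close>

section \<open>Integration over discrete distributions\<close>

lemma nn_integral_pmf_commute:
  "(\<integral>\<^sup>+x. \<integral>\<^sup>+y. f x y \<partial>measure_pmf q \<partial>measure_pmf p)
     = (\<integral>\<^sup>+y. \<integral>\<^sup>+x. f x y \<partial>measure_pmf p \<partial>measure_pmf q)"
proof -
  \<comment> \<open>Two independent draws can be made in either order, so Tonelli reduces to
    \<open>bind_commute_pmf\<close> for the joint law.\<close>
  have "(\<integral>\<^sup>+z. case_prod f z \<partial>measure_pmf (bind_pmf p (\<lambda>x. bind_pmf q (\<lambda>y. return_pmf (x, y)))))
    = (\<integral>\<^sup>+z. case_prod f z \<partial>measure_pmf (bind_pmf q (\<lambda>y. bind_pmf p (\<lambda>x. return_pmf (x, y)))))"
    by (subst bind_commute_pmf) simp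
  then show ?thesis by simp
qed

lemma nn_integral_pmf_le_const:
  assumes "\<And>x. x \<in> set_pmf p \<Longrightarrow> f x \<le> c"
  shows "(\<integral>\<^sup>+x. f x \<partial>measure_pmf p) \<le> c"
proof -
  have "(\<integral>\<^sup>+x. f x \<partial>measure_pmf p) \<le> (\<integral>\<^sup>+x. c \<partial>measure_pmf p)"
    using assms by (intro nn_integral_mono_AE) (simp add: AE_measure_pmf_iff)
  then show ?thesis by simp
qed

subsection \<open>The probability of isolating a row without any information\<close>

lemma isolates_mset: "isolates p (mset xs) \<longleftrightarrow> length (filter (\<lambda>i. p i = 1) xs) = 1"
  by (simp add: isolates_def flip: mset_filter)

lemma map_replicate_pmf: "map_pmf (map f) (replicate_pmf m D) = replicate_pmf m (map_pmf f D)"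
proof (induction m)
  case (Suc m)
  then show ?case
    by (simp add: map_bind_pmf bind_map_pmf Suc[symmetric])
qed simp

lemma map_pmf_bernoulli: "map_pmf Q D = bernoulli_pmf (measure_pmf.prob D {i. Q i})"
proof (rule pmf_eqI)
  fix b
  have "measure_pmf.prob D {i. \<not> Q i} = 1 - measure_pmf.prob D {i. Q i}"
    using measure_pmf.prob_compl[of "{i. Q i}" D] by (simp add: Compl_eq_Diff_UNIV[symmetric] Collect_neg_eq)
  then show "pmf (map_pmf Q D) b = pmf (bernoulli_pmf (measure_pmf.prob D {i. Q i})) b"
    by (cases b) (simp_all add: pmf_map vimage_def)
qed

text \<open>Testing each draw turns the sample into \<open>M\<close> independent Bernoulli coins,
  and the formula is the binomial mass at 1.\<close>

lemma prob_isolates: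
  "measure_pmf.prob (map_pmf mset (replicate_pmf M D)) {S. isolates p S}
     = M * measure_pmf.prob D {i. p i = 1} * (1 - measure_pmf.prob D {i. p i = 1}) ^ (M - 1)"
proof -
  let ?w = "measure_pmf.prob D {i. p i = 1}"
  have "binomial_pmf M ?w = map_pmf (length \<circ> filter id) (map_pmf (map (\<lambda>i. p i = 1)) (replicate_pmf M D))"
    by (simp add: binomial_pmf_altdef map_replicate_pmf map_pmf_bernoulli)
  also have "\<dots> = map_pmf (\<lambda>xs. length (filter (\<lambda>i. p i = 1) xs)) (replicate_pmf M D)"
    by (simp add: pmf.map_comp o_def filter_map)
  finally have "pmf (binomial_pmf M ?w) 1 = measure_pmf.prob (replicate_pmf M D) {xs. isolates p (mset xs)}"
    by (simp add: pmf_map vimage_def isolates_mset)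
  then show ?thesis by (simp add: vimage_def)
qed

lemma pop_mean_predicate:
  assumes "p \<in> predicates n" "set_pmf D \<subseteq> domain_set n"
  shows "pop_mean p D = measure_pmf.prob D {i. p i = 1}"
proof -
  have "pop_mean p D = (\<integral>i. indicator {i. p i = 1} i \<partial>measure_pmf D)"
    unfolding pop_mean_def
  proof (intro integral_cong_AE)
    show "AE i in measure_pmf D. p i = indicator {i. p i = 1} i"
      using assms by (fastforce simp: AE_measure_pmf_iff predicates_def indicator_def)
  qed simp_all
  then show ?thesis by simp
qed

lemma negligible_fun_dominated:
  assumes "\<And>m. f m \<ge> 0"
    and "\<And>c. \<forall>\<^sub>F m in sequentially. f m \<le> C / real m ^ c"
  shows "negligible_fun f"
  unfolding negligible_fun_def
proof (intro conjI allI assms)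
  fix c
  \<comment> \<open>One spare power of \<open>m\<close> turns the \<open>O\<close> bound into an
    \<open>o\<close> bound.\<close>
  have "f \<in> O(\<lambda>m. 1 / real m ^ Suc c)"
    using assms(2)[of "Suc c"] assms(1)
    by (intro bigoI[of _ C]) (auto elim!: eventually_mono)
  also have "(\<lambda>m. 1 / real m ^ Suc c) \<in> o(\<lambda>m. 1 / real m ^ c)"
    by real_asymp
  finally show "f \<in> o(\<lambda>m. 1 / real m ^ c)" .
qed

lemma negligible_fun_root:
  assumes f: "negligible_fun f" and k: "k > 0" and C: "C \<ge> 0"
  shows "negligible_fun (\<lambda>m. C * root k (f m))"
proof (rule negligible_fun_dominated)
  fix c
  \<comment> \<open>Exponent \<open>c * k\<close> is what leaves exponent \<open>c\<close> after the
    \<open>k\<close>-th root.\<close>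
  have "f \<in> o(\<lambda>m. 1 / real m ^ (c * k))"
    using f by (simp add: negligible_fun_def)
  from landau_o.smallD[OF this, of 1]
  show "\<forall>\<^sub>F m in sequentially. C * root k (f m) \<le> C / real m ^ c"
  proof (rule eventually_mono)
    fix m assume "norm (f m) \<le> 1 * norm (1 / real m ^ (c * k))"
    then have "f m \<le> (1 / real m ^ c) ^ k"
      by (simp add: power_divide power_mult)
    then have "root k (f m) \<le> root k ((1 / real m ^ c) ^ k)"
      using k by (rule real_root_le_mono[rotated])
    also have "\<dots> = 1 / real m ^ c"
      using k by (intro real_root_power_cancel) simp_all
    finally show "C * root k (f m) \<le> C / real m ^ c"
      using C mult_left_mono by fastforce
  qed simp
qed (use f k C in \<open>simp add: negligible_fun_def\<close>)

text \<open>The bound depends on \<open>w\<close> and \<open>M\<close> only, so it serves all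
  \<open>n\<close>, \<open>D\<close> and \<open>p\<close>. For low weight the factor
  \<open>(1 - ?v) ^ (M - 1)\<close> is dropped; for high weight the factor \<open>?v\<close>, since
  \<open>exp (- M * w M)\<close> beats every power of \<open>M\<close>.\<close>

lemma isolation_bound:
  assumes "(\<exists>w. negligible_fun w \<and> P = P_low w) \<or> (\<exists>w. super_log_weight w \<and> P = P_high w)"
  shows "\<exists>\<nu>. negligible_fun \<nu> \<and> (\<forall>n D M. \<forall>p\<in>P n D M. set_pmf D \<subseteq> domain_set n \<longrightarrow>
    measure_pmf.prob (map_pmf mset (replicate_pmf M D)) {S. isolates p S} \<le> \<nu> M)"
  using assms
proof (elim disjE exE conjE)
  fix w assume w: "negligible_fun w" "P = P_low w"
  have "negligible_fun (\<lambda>m. m * w m)"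
    unfolding negligible_fun_def
  proof (intro conjI allI)
    fix c
    have "(\<lambda>m. m * w m) \<in> o(\<lambda>m. m * (1 / real m ^ Suc c))"
      using w by (intro landau_o.small.mult_left) (auto simp: negligible_fun_def simp del: power_Suc)
    also have "(\<lambda>m. m * (1 / real m ^ Suc c)) \<in> O(\<lambda>m. 1 / real m ^ c)"
      by real_asymp
    finally show "(\<lambda>m. m * w m) \<in> o(\<lambda>m. 1 / real m ^ c)" .
  qed (use w in \<open>simp add: negligible_fun_def\<close>)
  moreover have "measure_pmf.prob (map_pmf mset (replicate_pmf M D)) {S. isolates p S} \<le> M * w M"
    if p: "p \<in> P n D M" and D: "set_pmf D \<subseteq> domain_set n" for n D M p
  proof -
    let ?v = "measure_pmf.prob D {i. p i = 1}"
    have "?v \<le> w M"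
      using p w D pop_mean_predicate[of p n D] by (simp add: P_low_def)
    have "M * ?v * (1 - ?v) ^ (M - 1) \<le> M * ?v * 1"
      by (intro mult_left_mono power_le_one) simp_all
    also have "\<dots> \<le> M * w M"
      using \<open>?v \<le> w M\<close> by (simp add: mult_left_mono)
    finally show ?thesis by (simp only: prob_isolates)
  qed
  ultimately show ?thesis by blast
next
  fix w assume w: "super_log_weight w" "P = P_high w"
  \<comment> \<open>The factor \<open>exp 1\<close> pays for the exponent \<open>M - 1\<close> in
    place of \<open>M\<close>: the difference is \<open>exp (w M)\<close>, and
    \<open>w M <= 1\<close> as soon as the class has a member.\<close>
  let ?\<nu> = "\<lambda>m. exp 1 * real m * exp (- real m * w m)"
  have "negligible_fun ?\<nu>"
  proof (rule negligible_fun_dominated)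
    fix c
    \<comment> \<open>The multiple is \<open>Suc c\<close> because one power of \<open>m\<close>
      cancels the factor \<open>m\<close> in \<open>?\<nu>\<close>.\<close>
    have "\<forall>\<^sub>F m in sequentially. w m \<ge> real (Suc c) * (ln m / m)"
    proof -
      have "w \<in> \<omega>(\<lambda>m. ln (real m) / real m)"
        using w by (simp add: super_log_weight_def)
      from landau_omega.smallD[OF this, of "real (Suc c)"]
      have "\<forall>\<^sub>F m in sequentially. real (Suc c) * norm (ln (real m) / real m) \<le> norm (w m)"
        by simp
      then show ?thesis using eventually_gt_at_top[of 1]
      proof eventually_elim
        case (elim m)
        then show ?case using w(1) by (simp add: super_log_weight_def)
      qed
    qed
    then show "\<forall>\<^sub>F m in sequentially. ?\<nu> m \<le> exp 1 / real m ^ c"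
      using eventually_gt_at_top[of 1]
    proof eventually_elim
      case (elim m)
      then have "Suc c * ln m \<le> m * w m" by (simp add: field_simps)
      then have "exp (- m * w m) \<le> exp (- (Suc c * ln m))" by simp
      also have "\<dots> = 1 / real m ^ Suc c"
        using elim by (simp only: exp_minus exp_of_nat_mult exp_ln inverse_eq_divide)
      finally have "?\<nu> m \<le> exp 1 * m * (1 / real m ^ Suc c)"
        by (intro mult_left_mono) simp_all
      then show ?case using elim by simp
    qed
  qed simp
  moreover have "measure_pmf.prob (map_pmf mset (replicate_pmf M D)) {S. isolates p S} \<le> ?\<nu> M"
    if p: "p \<in> P n D M" and D: "set_pmf D \<subseteq> domain_set n" for n D M p
  proof (cases "M = 0")
    case False
    let ?v = "measure_pmf.prob D {i. p i = 1}"
    have v: "w M \<le> ?v" "?v \<le> 1" "0 \<le> w M"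
      using p w D pop_mean_predicate[of p n D] by (simp_all add: P_high_def super_log_weight_def)
    then have w1: "w M \<le> 1" by linarith
    have "M * ?v * (1 - ?v) ^ (M - 1) \<le> M * (1 - w M) ^ (M - 1)"
      using v by (intro mult_mono power_mono mult_left_le) simp_all
    also have "\<dots> \<le> M * exp (- w M) ^ (M - 1)"
      using exp_ge_add_one_self[of "- w M"] w1 by (intro mult_left_mono power_mono) simp_all
    also have "\<dots> = M * exp (w M) * exp (- real M * w M)"
      using False by (simp add: exp_of_nat_mult[symmetric] of_nat_diff algebra_simps flip: exp_add)
    also have "\<dots> \<le> M * exp 1 * exp (- real M * w M)"
      using w1 by (intro mult_right_mono mult_left_mono) simp_all
    finally show ?thesis by (simp only: prob_isolates mult_ac)
  qed (simp add: isolates_def)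
  ultimately show ?thesis by blast
qed

subsection \<open>Counting the replies of the mechanism\<close>

text \<open>A superset of what an update can produce, described without the sample: \<open>k\<close>
  covers the rounded values of means in [-1, 1]. The new state records the sign, so \<open>s\<close>
  is counted too, without tying it to \<open>k\<close>.\<close>

definition update_replies :: "real \<Rightarrow> real \<Rightarrow> vec multiset \<Rightarrow> vec \<Rightarrow> (real \<times> vec multiset) set" where
  "update_replies \<epsilon> lam G q =
     (\<lambda>(k, s). (\<epsilon> / 2 * of_int k, add_mset (\<lambda>i. - (lam * \<epsilon> * s * q i / 16)) G))
       ` ({- round (2 / \<epsilon>)..round (2 / \<epsilon>)} \<times> {1, - 1})"

lemma finite_update_replies: "finite (update_replies \<epsilon> lam G q)"
  by (simp add: update_replies_def)

lemma size_update_replies: "z \<in> update_replies \<epsilon> lam G q \<Longrightarrow> size (snd z) = Suc (size G)"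
  by (auto simp: update_replies_def)

lemma card_update_replies:
  assumes "0 < \<epsilon>" "\<epsilon> < 1"
  shows "real (card (update_replies \<epsilon> lam G q)) \<le> 12 / \<epsilon>"
proof -
  let ?R = "round (2 / \<epsilon>)"
  have "real (card (update_replies \<epsilon> lam G q)) \<le> real (card ({- ?R..?R} \<times> {1, - 1 :: real}))"
    unfolding update_replies_def by (intro of_nat_mono card_image_le) simp
  also have "\<dots> = 2 * real (nat (2 * ?R + 1))"
    by (simp add: card_cartesian_product)
  also have "\<dots> = 2 * (2 * real_of_int ?R + 1)"
    using assms round_mono[of 0 "2 / \<epsilon>"] by simp
  also have "\<dots> \<le> 2 * (4 / \<epsilon> + 2)"
    using of_int_round_le[of "2 / \<epsilon>"] by simp
  also have "\<dots> \<le> 12 / \<epsilon>"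
    using assms by (simp add: field_simps)
  finally show ?thesis .
qed

lemma abs_sample_mean_le_1:
  assumes "q \<in> queries n" "set_mset S \<subseteq> domain_set n"
  shows "\<bar>sample_mean q S\<bar> \<le> 1"
proof -
  have "\<bar>\<Sum>i\<in>#S. q i\<bar> \<le> real (size S)"
    using assms(2)
  proof (induction S)
    case (add x S)
    then have "q x \<in> {-1, 1}"
      using assms(1) by (auto simp: queries_def)
    then show ?case using add by auto
  qed simp
  then show ?thesis
    by (simp add: sample_mean_def divide_le_eq)
qed

lemma abs_round_le:
  fixes x y :: real
  assumes "\<bar>x\<bar> \<le> y"
  shows "\<bar>round x\<bar> \<le> round y"
proof -
  have "round x \<le> round y" "round (- y) \<le> round x"
    using assms by (auto intro!: round_mono)
  \<comment> \<open>Halves are rounded up, so \<open>round\<close> is not odd; the inequality holds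
    in the direction needed.\<close>
  moreover have "- round y \<le> round (- y)"
    unfolding round_def by linarith
  ultimately show ?thesis by simp
qed

lemma update_in_update_replies:
  assumes "q \<in> queries n" "set_mset S \<subseteq> domain_set n" "0 < \<epsilon>"
  shows "(round_to_multiple (\<epsilon> / 2) (sample_mean q S),
           add_mset (\<lambda>i. - (lam * \<epsilon> * sign_pm r * q i / 16)) G) \<in> update_replies \<epsilon> lam G q"
proof -
  have "\<bar>sample_mean q S / (\<epsilon> / 2)\<bar> \<le> 2 / \<epsilon>"
    using abs_sample_mean_le_1[OF assms(1,2)] assms(3) by (simp add: field_simps abs_mult)
  then have "\<bar>round (sample_mean q S / (\<epsilon> / 2))\<bar> \<le> round (2 / \<epsilon>)"
    by (rule abs_round_le)
  then show ?thesis
    unfolding update_replies_def round_to_multiple_def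
    by (intro image_eqI[of _ _ "(round (sample_mean q S / (\<epsilon> / 2)), sign_pm r)"])
       (auto simp: sign_pm_def)
qed

text \<open>
  Here \<open>B s j\<close> bounds the sample average of the payoff \<open>f\<close> when \<open>j\<close> updates have been made and
  \<open>s\<close> rounds have been unrolled from the end of the game. The sample must stay averaged out: the
  pointwise bound \<open>f S (g S G q u) \<le> f S (u / lam, G) + (\<Sum>z\<in>U. f S z)\<close> replaces the reply, which
  depends on \<open>S\<close>, by a sum over replies that do not.
\<close>

lemma nn_integral_interaction_le:
  fixes f :: "nat multiset \<Rightarrow> transcript \<times> vec multiset \<Rightarrow> ennreal"
    and B :: "nat \<Rightarrow> nat \<Rightarrow> ennreal"
  assumes qs: "\<And>h. set_pmf (qs h) \<subseteq> queries n"
    and Q: "\<And>S. S \<in> set_pmf Q \<Longrightarrow> set_mset S \<subseteq> domain_set n"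
    and \<epsilon>: "0 < \<epsilon>" "\<epsilon> < 1"
    and B: "\<And>s j. B s j + (if real j \<le> 128 / (lam * \<epsilon>)\<^sup>2 then ennreal (12 / \<epsilon>) * B s (Suc j) else 0)
              \<le> B (Suc s) j"
    and f: "\<And>h G. (\<integral>\<^sup>+S. f S (h, G) \<partial>measure_pmf Q) \<le> B s (size G)"
  shows "(\<integral>\<^sup>+S. \<integral>\<^sup>+z. f S z \<partial>measure_pmf (interaction qs (AQA_OGD n T \<epsilon> \<delta>\<^sub>0 lam) S t) \<partial>measure_pmf Q)
           \<le> B (s + t) 0"
  using f
\<comment> \<open>The recursion of \<open>interaction\<close> exposes the last round, which is
  integrated into a new payoff; hence the generalization over \<open>f\<close> and
  \<open>s\<close>.\<close>
proof (induction t arbitrary: s f)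
  case 0
  then show ?case using "0"[of "[]" "{#}"] by (simp add: AQA_OGD_def)
next
  case (Suc t)
  let ?ip = "\<lambda>q G. IP_est n T q G (lam * \<epsilon> / 8) (\<delta>\<^sub>0 / (2 * real T))"
  \<comment> \<open>For a fixed estimate \<open>u\<close> the reply is a function of
    \<open>S\<close>; the law of \<open>u\<close> involves only \<open>q\<close> and
    \<open>G\<close>.\<close>
  define g where "g S G q u =
      (if \<bar>u - lam * sample_mean q S\<bar> > lam * \<epsilon> / 2 \<and> real (size G) \<le> 128 / (lam * \<epsilon>)\<^sup>2
       then (round_to_multiple (\<epsilon> / 2) (sample_mean q S),
             add_mset (\<lambda>i. - (lam * \<epsilon> * sign_pm (u - lam * sample_mean q S) * q i / 16)) G)
       else (u / lam, G))" for S G q u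
  have answer: "answer (AQA_OGD n T \<epsilon> \<delta>\<^sub>0 lam) S G q = map_pmf (g S G q) (?ip q G)" for S G q
    by (simp add: AQA_OGD_def AQA_OGD_answer_def g_def map_pmf_def Let_def cong: if_cong)
  define f' where "f' S z = (\<integral>\<^sup>+q. \<integral>\<^sup>+u. f S (fst z @ [(q, fst (g S (snd z) q u))], snd (g S (snd z) q u))
      \<partial>measure_pmf (?ip q (snd z)) \<partial>measure_pmf (qs (fst z)))" for S z
  have step: "(\<integral>\<^sup>+z. f S z \<partial>measure_pmf (interaction qs (AQA_OGD n T \<epsilon> \<delta>\<^sub>0 lam) S (Suc t)))
     = (\<integral>\<^sup>+z. f' S z \<partial>measure_pmf (interaction qs (AQA_OGD n T \<epsilon> \<delta>\<^sub>0 lam) S t))" for S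
    by (simp add: f'_def answer case_prod_beta)
  have one: "(\<integral>\<^sup>+S. f S (h @ [(q, fst (g S G q u))], snd (g S G q u)) \<partial>measure_pmf Q)
      \<le> B (Suc s) (size G)" if q: "q \<in> queries n" for h G q u
  proof -
    \<comment> \<open>Beyond the cap only the default reply is possible, so there is nothing to sum
      over.\<close>
    define U where "U = (if real (size G) \<le> 128 / (lam * \<epsilon>)\<^sup>2 then update_replies \<epsilon> lam G q else {})"
    have U: "finite U" by (simp add: U_def finite_update_replies)
    have gU: "g S G q u \<in> insert (u / lam, G) U" if "S \<in> set_pmf Q" for S
      using update_in_update_replies[OF q Q[OF that] \<epsilon>(1)] by (auto simp: g_def U_def)
    let ?F = "\<lambda>S z. f S (h @ [(q, fst z)], snd z)"
    have "?F S (g S G q u) \<le> ?F S (u / lam, G) + (\<Sum>z\<in>U. ?F S z)" if "S \<in> set_pmf Q" for S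
    proof (cases "g S G q u = (u / lam, G)")
      case False
      with gU[OF that] have "g S G q u \<in> U" by blast
      then have "?F S (g S G q u) \<le> (\<Sum>z\<in>U. ?F S z)"
        using U by (intro member_le_sum) auto
      then show ?thesis by (simp add: add_increasing)
    qed simp
    then have "(\<integral>\<^sup>+S. ?F S (g S G q u) \<partial>measure_pmf Q)
        \<le> (\<integral>\<^sup>+S. ?F S (u / lam, G) + (\<Sum>z\<in>U. ?F S z) \<partial>measure_pmf Q)"
      by (intro nn_integral_mono_AE) (simp add: AE_measure_pmf_iff)
    also have "\<dots> = (\<integral>\<^sup>+S. ?F S (u / lam, G) \<partial>measure_pmf Q)
        + (\<Sum>z\<in>U. \<integral>\<^sup>+S. ?F S z \<partial>measure_pmf Q)"
      by (simp add: nn_integral_add nn_integral_sum)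
    also have "\<dots> \<le> B s (size G) + (\<Sum>z\<in>U. B s (Suc (size G)))"
    proof (intro add_mono sum_mono)
      fix z assume "z \<in> U"
      then have "size (snd z) = Suc (size G)"
        by (auto simp: U_def size_update_replies split: if_splits)
      then show "(\<integral>\<^sup>+S. ?F S z \<partial>measure_pmf Q) \<le> B s (Suc (size G))"
        using Suc.prems[of "h @ [(q, fst z)]" "snd z"] by simp
    qed (use Suc.prems in simp)
    also have "\<dots> \<le> B s (size G) + (if real (size G) \<le> 128 / (lam * \<epsilon>)\<^sup>2
                then ennreal (12 / \<epsilon>) * B s (Suc (size G)) else 0)"
    proof -
      have "of_nat (card (update_replies \<epsilon> lam G q)) \<le> ennreal (12 / \<epsilon>)"
        using card_update_replies[OF \<epsilon>] by (simp add: ennreal_of_nat_eq_real_of_nat ennreal_leI)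
      then show ?thesis
        by (auto simp: U_def intro!: add_left_mono mult_right_mono)
    qed
    also have "\<dots> \<le> B (Suc s) (size G)" by (rule B)
    finally show ?thesis .
  qed
  have "(\<integral>\<^sup>+S. f' S (h, G) \<partial>measure_pmf Q) \<le> B (Suc s) (size G)" for h G
  proof -
    \<comment> \<open>Neither the law of the query nor that of the estimate involves
      \<open>S\<close>, so the average over \<open>S\<close> moves innermost and \<open>one\<close>
      applies for each \<open>q\<close> and \<open>u\<close>.\<close>
    have "(\<integral>\<^sup>+S. f' S (h, G) \<partial>measure_pmf Q)
      = (\<integral>\<^sup>+q. \<integral>\<^sup>+u. \<integral>\<^sup>+S. f S (h @ [(q, fst (g S G q u))], snd (g S G q u))
          \<partial>measure_pmf Q \<partial>measure_pmf (?ip q G) \<partial>measure_pmf (qs h))"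
      unfolding f'_def fst_conv snd_conv
      by (subst nn_integral_pmf_commute, subst (2) nn_integral_pmf_commute) (rule refl)
    also have "\<dots> \<le> B (Suc s) (size G)"
    proof (rule nn_integral_pmf_le_const, rule nn_integral_pmf_le_const)
      fix q u assume "q \<in> set_pmf (qs h)"
      then have "q \<in> queries n" using qs by blast
      then show "(\<integral>\<^sup>+S. f S (h @ [(q, fst (g S G q u))], snd (g S G q u)) \<partial>measure_pmf Q)
          \<le> B (Suc s) (size G)" by (rule one)
    qed
    finally show ?thesis .
  qed
  from Suc.IH[OF this] show ?case by (simp add: step del: interaction.simps)
qed

section \<open>From the interaction to the success probability\<close>

lemma Succ_AQA_OGD_le:
  fixes B :: "nat \<Rightarrow> nat \<Rightarrow> real"
  assumes A: "adversary_on n A" and D: "set_pmf D \<subseteq> domain_set n"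
    and \<epsilon>: "0 < \<epsilon>" "\<epsilon> < 1"
    and B0: "\<And>s j. 0 \<le> B s j"
    and B: "\<And>s j. B s j + (if real j \<le> 128 / (lam * \<epsilon>)\<^sup>2 then 12 / \<epsilon> * B s (Suc j) else 0) \<le> B (Suc s) j"
    and iso: "\<And>p j. p \<in> P \<Longrightarrow>
        measure_pmf.prob (map_pmf mset (replicate_pmf M D)) {S. isolates p S} \<le> B 0 j"
  shows "Succ A (AQA_OGD n T \<epsilon> \<delta>\<^sub>0 lam) P D M T \<le> B T 0"
proof -
  let ?Q = "map_pmf mset (replicate_pmf M D)"
  let ?M = "AQA_OGD n T \<epsilon> \<delta>\<^sub>0 lam"
  let ?W = "{(S, p). isolates p S \<and> p \<in> P}"
  define f where "f r S z = (\<integral>\<^sup>+p. indicator ?W (S, p) \<partial>measure_pmf (output_pred A r (fst z)))"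
    for r S and z :: "transcript \<times> vec multiset"
  have f: "(\<integral>\<^sup>+S. f r S (h, G) \<partial>measure_pmf ?Q) \<le> ennreal (B 0 (size G))" for r h G
  proof -
    \<comment> \<open>The law of the output depends on \<open>r\<close> and \<open>h\<close> only,
      so \<open>p\<close> can be fixed before averaging over \<open>S\<close>.\<close>
    have "(\<integral>\<^sup>+S. indicator ?W (S, p) \<partial>measure_pmf ?Q) \<le> ennreal (B 0 (size G))" for p
    proof (cases "p \<in> P")
      case True
      then have "(\<integral>\<^sup>+S. indicator ?W (S, p) \<partial>measure_pmf ?Q)
          = (\<integral>\<^sup>+S. indicator {S. isolates p S} S \<partial>measure_pmf ?Q)"
        by (intro nn_integral_cong) (simp add: indicator_def)
      also have "\<dots> = ennreal (measure_pmf.prob ?Q {S. isolates p S})"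
        by (simp add: measure_pmf.emeasure_eq_measure del: nn_integral_map_pmf measure_map_pmf emeasure_map_pmf)
      also have "\<dots> \<le> ennreal (B 0 (size G))"
        using iso[OF True] by (rule ennreal_leI)
      finally show ?thesis .
    qed simp
    then show ?thesis
      unfolding f_def fst_conv by (subst nn_integral_pmf_commute) (rule nn_integral_pmf_le_const)
  qed
  have "(\<integral>\<^sup>+S. \<integral>\<^sup>+z. f r S z \<partial>measure_pmf (interaction (next_query A r) ?M S T) \<partial>measure_pmf ?Q)
      \<le> ennreal (B (0 + T) 0)" for r
  proof (rule nn_integral_interaction_le[where B = "\<lambda>s j. ennreal (B s j)"])
    show "set_pmf (next_query A r h) \<subseteq> queries n" for h
      using A by (simp add: adversary_on_def)
    show "set_mset S \<subseteq> domain_set n" if "S \<in> set_pmf ?Q" for S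
      using that D by (auto simp: set_replicate_pmf)
    show "ennreal (B s j) + (if real j \<le> 128 / (lam * \<epsilon>)\<^sup>2
        then ennreal (12 / \<epsilon>) * ennreal (B s (Suc j)) else 0) \<le> ennreal (B (Suc s) j)" for s j
      using B[of s j] B0 \<epsilon> by (auto simp flip: ennreal_mult ennreal_plus intro!: ennreal_leI)
  qed (use \<epsilon> f in auto)
  then have "(\<integral>\<^sup>+r. \<integral>\<^sup>+S. \<integral>\<^sup>+z. f r S z \<partial>measure_pmf (interaction (next_query A r) ?M S T)
      \<partial>measure_pmf ?Q \<partial>measure_pmf (coins A)) \<le> ennreal (B T 0)"
    by (intro nn_integral_pmf_le_const[of "coins A"]) simp
  \<comment> \<open>The bound holds for each seed; exchanging the integrals restores the order of
    the game, which draws the sample first.\<close>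
  then have "(\<integral>\<^sup>+S. \<integral>\<^sup>+r. \<integral>\<^sup>+z. f r S z \<partial>measure_pmf (interaction (next_query A r) ?M S T)
      \<partial>measure_pmf (coins A) \<partial>measure_pmf ?Q) \<le> ennreal (B T 0)"
    by (subst nn_integral_pmf_commute)
  also have "(\<integral>\<^sup>+S. \<integral>\<^sup>+r. \<integral>\<^sup>+z. f r S z \<partial>measure_pmf (interaction (next_query A r) ?M S T)
      \<partial>measure_pmf (coins A) \<partial>measure_pmf ?Q) = emeasure (pso_game A ?M D M T) ?W"
    by (simp add: pso_game_def f_def case_prod_beta)
  finally show ?thesis
    unfolding Succ_def using B0 by (simp add: measure_pmf.emeasure_eq_measure)
qed

section \<open>Numerical bounds on the number of reply patterns\<close>

text \<open>The first count lets every round update and serves for small \<open>T\<close>; the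
  second allows \<open>nat \<lfloor>x\<rfloor> + 1\<close> updates and serves for large
  \<open>T\<close>. At \<open>T = 1\<close> the power of \<open>T\<close> is 1 and the prefactor
  carries the bound.\<close>

lemma replies_count_le:
  fixes \<epsilon> x :: real and T :: nat
  assumes \<epsilon>: "0 < \<epsilon>" "\<epsilon> < 1" and x: "128 / \<epsilon>\<^sup>2 \<le> x" and T: "T \<ge> 1"
  shows "min ((1 + 12 / \<epsilon>) ^ T) ((1 + T * (12 / \<epsilon>)) ^ Suc (nat \<lfloor>x\<rfloor>)) \<le> 16 / \<epsilon> * T powr (4 * x)"
proof -
  \<comment> \<open>The constant 16 serves twice: \<open>y\<close> is at least
    \<open>1 + 12 / \<epsilon>\<close>, and \<open>2 * y\<^sup>2\<close> equals
    \<open>4 * (128 / \<epsilon>\<^sup>2)\<close>.\<close>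
  define y where "y = 16 / \<epsilon>"
  have y: "16 < y" using \<epsilon> by (simp add: y_def field_simps)
  have y2: "2 * y\<^sup>2 \<le> 4 * x" using x by (simp add: y_def power_divide)
  have "16\<^sup>2 \<le> y\<^sup>2" using y by (intro power_mono) simp_all
  with y2 have x1: "1 \<le> x" by simp
  have y1: "1 + 12 / \<epsilon> \<le> y" using \<epsilon> by (simp add: y_def field_simps)
  consider "T = 1" | "T \<ge> 2" "T < y" | "y \<le> T" using T by linarith
  then show ?thesis
  proof cases
    case 1
    then show ?thesis using y1 by (simp add: y_def)
  next
    case 2
    have "y \<le> exp y" using exp_ge_add_one_self[of y] by linarith
    also have "exp y = exp 1 powr y" by (simp add: powr_def)
    also have "\<dots> \<le> 4 powr y" using exp_le y by (intro powr_mono2) auto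
    finally have *: "y \<le> 4 powr y" .
    \<comment> \<open>As \<open>T < y\<close>, the count is at most \<open>y powr y\<close>, hence
      at most \<open>2 powr (2 * y\<^sup>2)\<close>; then \<open>T >= 2\<close> replaces the base
      2.\<close>
    have "(1 + 12 / \<epsilon>) ^ T \<le> y ^ T" using y1 \<epsilon> by (intro power_mono) auto
    also have "\<dots> = y powr T" using y by (simp add: powr_realpow)
    also have "\<dots> \<le> y powr y" using y 2 by (intro powr_mono) auto
    also have "\<dots> \<le> (4 powr y) powr y" using * y by (intro powr_mono2) auto
    also have "\<dots> = (2 powr 2) powr y\<^sup>2" by (simp add: powr_powr power2_eq_square)
    also have "\<dots> = 2 powr (2 * y\<^sup>2)" by (simp only: powr_powr)
    also have "\<dots> \<le> 2 powr (4 * x)" using y2 by (intro powr_mono) auto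
    also have "\<dots> \<le> T powr (4 * x)" using 2 x1 by (intro powr_mono2) auto
    also have "\<dots> \<le> y * T powr (4 * x)" using y mult_right_mono[of 1 y] by simp
    finally show ?thesis by (simp add: y_def)
  next
    case 3
    \<comment> \<open>With \<open>y <= T\<close> the base is at most the square of \<open>T\<close>;
      the doubled exponent stays below \<open>4 * x\<close> because \<open>x >= 1\<close>.\<close>
    have "1 + T * (12 / \<epsilon>) \<le> T * y"
    proof -
      have "1 \<le> real T * 1" using T by simp
      also have "\<dots> \<le> T * (4 / \<epsilon>)" using \<epsilon> by (intro mult_left_mono) (auto simp: field_simps)
      finally show ?thesis using \<epsilon> by (simp add: y_def field_simps)
    qed
    also have "\<dots> \<le> (real T)\<^sup>2" using 3 by (simp add: power2_eq_square mult_left_mono)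
    finally have "(1 + T * (12 / \<epsilon>)) ^ Suc (nat \<lfloor>x\<rfloor>) \<le> ((real T)\<^sup>2) ^ Suc (nat \<lfloor>x\<rfloor>)"
      using \<epsilon> by (intro power_mono) auto
    also have "\<dots> = T powr (2 * real (Suc (nat \<lfloor>x\<rfloor>)))"
    proof -
      have "2 * real k = real (2 * k)" for k by simp
      then show ?thesis using T by (simp only: powr_realpow of_nat_0_less_iff power_mult)
    qed
    also have "\<dots> \<le> T powr (4 * x)"
    proof (intro powr_mono)
      obtain k where k: "nat \<lfloor>x\<rfloor> = k" "real k \<le> x" using x1 by simp
      show "2 * real (Suc (nat \<lfloor>x\<rfloor>)) \<le> 4 * x"
        unfolding k(1) using k(2) x1 by simp
    qed (use T in simp)
    also have "\<dots> \<le> y * T powr (4 * x)" using y mult_right_mono[of 1 y] by simp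
    finally show ?thesis by (simp add: y_def)
  qed
qed

lemma Succ_AQA_OGD_le_powr:
  assumes A: "adversary_on n A" and D: "set_pmf D \<subseteq> domain_set n" and T: "T \<ge> 1"
    and \<epsilon>: "0 < \<epsilon>" "\<epsilon> < 1" and lam: "0 < lam" "lam \<le> 1" and b: "0 \<le> b"
    and iso: "\<And>p. p \<in> P \<Longrightarrow>
        measure_pmf.prob (map_pmf mset (replicate_pmf M D)) {S. isolates p S} \<le> b"
  shows "Succ A (AQA_OGD n T \<epsilon> \<delta>\<^sub>0 lam) P D M T
    \<le> 16 / \<epsilon> * T powr (4 * (128 / (lam * \<epsilon>)\<^sup>2)) * b"
proof -
  let ?Succ = "Succ A (AQA_OGD n T \<epsilon> \<delta>\<^sub>0 lam) P D M T"
  define V where "V = 12 / \<epsilon>"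
  define x where "x = 128 / (lam * \<epsilon>)\<^sup>2"
  \<comment> \<open>The cap is tested before the update, so sizes from 0 to the floor of
    \<open>x\<close> permit one: \<open>K\<close> updates in all.\<close>
  define K where "K = Suc (nat \<lfloor>x\<rfloor>)"
  have V: "0 \<le> V" using \<epsilon> by (simp add: V_def)
  have "?Succ \<le> (1 + V) ^ T * b"
  \<comment> \<open>Each remaining round contributes one default reply and at most \<open>V\<close>
    updates.\<close>
  proof (rule Succ_AQA_OGD_le[where B = "\<lambda>s j. (1 + V) ^ s * b"])
    show "(1 + V) ^ s * b + (if real j \<le> 128 / (lam * \<epsilon>)\<^sup>2 then 12 / \<epsilon> * ((1 + V) ^ s * b) else 0)
        \<le> (1 + V) ^ Suc s * b" for s j
      using V b by (simp add: algebra_simps flip: V_def)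
  qed (use A D \<epsilon> V b iso in auto)
  moreover have "?Succ \<le> (1 + T * V) ^ (K - 0) * b"
  \<comment> \<open>Each of the \<open>K - j\<close> updates left is either absent or given one of
    \<open>s\<close> rounds and a reply, in at most \<open>1 + s * V\<close> ways.\<close>
  proof (rule Succ_AQA_OGD_le[where B = "\<lambda>s j. (1 + s * V) ^ (K - j) * b"])
    show "(1 + s * V) ^ (K - j) * b
        + (if real j \<le> 128 / (lam * \<epsilon>)\<^sup>2 then 12 / \<epsilon> * ((1 + s * V) ^ (K - Suc j) * b) else 0)
        \<le> (1 + Suc s * V) ^ (K - j) * b" for s j
    proof (cases "real j \<le> x")
      case True
      then have "j < K" by (simp add: K_def le_nat_floor less_Suc_eq_le)
      then have K: "K - j = Suc (K - Suc j)" by simp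
      \<comment> \<open>Factoring out the common power raises one base to
        \<open>1 + Suc s * V\<close>; monotonicity raises the others.\<close>
      have "(1 + s * V) ^ (K - j) + V * (1 + s * V) ^ (K - Suc j)
          = (1 + Suc s * V) * (1 + s * V) ^ (K - Suc j)"
        unfolding K by (simp add: algebra_simps)
      also have "\<dots> \<le> (1 + Suc s * V) * (1 + Suc s * V) ^ (K - Suc j)"
        using V by (intro mult_left_mono power_mono add_left_mono mult_right_mono add_nonneg_nonneg) auto
      also have "\<dots> = (1 + Suc s * V) ^ (K - j)"
        unfolding K by simp
      finally have "((1 + s * V) ^ (K - j) + V * (1 + s * V) ^ (K - Suc j)) * b
          \<le> (1 + Suc s * V) ^ (K - j) * b"
        using b by (rule mult_right_mono)
      then show ?thesis using True by (simp add: distrib_right flip: V_def x_def)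
    next
      case False
      have "(1 + s * V) ^ (K - j) * b \<le> (1 + Suc s * V) ^ (K - j) * b"
        using V b by (intro mult_right_mono power_mono add_left_mono add_nonneg_nonneg) auto
      then show ?thesis using False by (simp flip: V_def x_def)
    qed
  qed (use A D \<epsilon> V b iso in auto)
  ultimately have "?Succ \<le> min ((1 + 12 / \<epsilon>) ^ T) ((1 + T * (12 / \<epsilon>)) ^ Suc (nat \<lfloor>x\<rfloor>)) * b"
    using b by (auto simp: V_def K_def min_def)
  also have "\<dots> \<le> 16 / \<epsilon> * T powr (4 * x) * b"
  proof (intro mult_right_mono replies_count_le)
    have "(lam * \<epsilon>)\<^sup>2 \<le> \<epsilon>\<^sup>2"
      using lam \<epsilon> by (intro power_mono mult_left_le_one_le) auto
    then show "128 / \<epsilon>\<^sup>2 \<le> x"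
      unfolding x_def using lam \<epsilon> by (intro divide_left_mono) auto
  qed (use \<epsilon> T b in auto)
  finally show ?thesis by (simp add: x_def)
qed

section \<open>Extraction of the fourth root\<close>

theorem theorem9:
  fixes P :: "nat \<Rightarrow> nat pmf \<Rightarrow> nat \<Rightarrow> (nat \<Rightarrow> real) set"
  assumes "(\<exists>w. negligible_fun w \<and> P = P_low w) \<or> (\<exists>w. super_log_weight w \<and> P = P_high w)"
  shows "\<exists>\<delta>. negligible_fun \<delta> \<and>
    (\<forall>(n::nat) (A::adversary) (D::nat pmf) (M::nat) (T::nat)
       (\<epsilon>::real) (lam::real) (\<delta>\<^sub>0::real).
       adversary_on n A \<longrightarrow> set_pmf D \<subseteq> domain_set n \<longrightarrow> M \<ge> 1 \<longrightarrow> T \<ge> 1 \<longrightarrow>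
       0 < \<epsilon> \<longrightarrow> \<epsilon> < 1 \<longrightarrow> 0 < lam \<longrightarrow> lam \<le> 1 \<longrightarrow> 0 < \<delta>\<^sub>0 \<longrightarrow> \<delta>\<^sub>0 < 1 \<longrightarrow>
       Succ A (AQA_OGD n T \<epsilon> \<delta>\<^sub>0 lam) (P n D M) D M T
         \<le> (1 / \<epsilon>) * real T powr (128 / (lam * \<epsilon>)\<^sup>2) * \<delta> M)"
proof -
  obtain \<nu> where \<nu>: "negligible_fun \<nu>"
    and iso: "\<And>n D M p. p \<in> P n D M \<Longrightarrow> set_pmf D \<subseteq> domain_set n \<Longrightarrow>
      measure_pmf.prob (map_pmf mset (replicate_pmf M D)) {S. isolates p S} \<le> \<nu> M"
    using isolation_bound[OF assms] by blast
  have \<nu>0: "0 \<le> \<nu> M" for M using \<nu> by (simp add: negligible_fun_def)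
  show ?thesis
  proof (intro exI[of _ "\<lambda>M. 2 * root 4 (\<nu> M)"] conjI allI impI)
    show "negligible_fun (\<lambda>M. 2 * root 4 (\<nu> M))"
      by (rule negligible_fun_root[OF \<nu>]) simp_all
  next
    fix n A D and M T :: nat and \<epsilon> lam \<delta>\<^sub>0 :: real
    assume A: "adversary_on n A" and D: "set_pmf D \<subseteq> domain_set n" and T: "T \<ge> 1"
      and \<epsilon>: "0 < \<epsilon>" "\<epsilon> < 1" and lam: "0 < lam" "lam \<le> 1"
    let ?Succ = "Succ A (AQA_OGD n T \<epsilon> \<delta>\<^sub>0 lam) (P n D M) D M T"
    let ?x = "128 / (lam * \<epsilon>)\<^sup>2"
    let ?bound = "(1 / \<epsilon>) * real T powr ?x * (2 * root 4 (\<nu> M))"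
    have Succ: "0 \<le> ?Succ" "?Succ \<le> 1" by (simp_all add: Succ_def)
    have "?Succ ^ 4 \<le> ?Succ"
      using Succ power_decreasing[of 1 4 ?Succ] by simp
    also have "\<dots> \<le> 16 / \<epsilon> * T powr (4 * ?x) * \<nu> M"
      using iso D \<nu>0 by (intro Succ_AQA_OGD_le_powr A D T \<epsilon> lam) auto
    \<comment> \<open>Weakening \<open>1 / \<epsilon>\<close> to \<open>1 / \<epsilon> ^ 4\<close>
      makes the right side a perfect fourth power; \<open>16 = 2 ^ 4\<close> explains the 2 in the
      witness.\<close>
    also have "\<dots> \<le> 16 / \<epsilon> ^ 4 * T powr (4 * ?x) * \<nu> M"
      using \<epsilon> power_decreasing[of 1 4 \<epsilon>] \<nu>0
      by (intro mult_right_mono divide_left_mono) auto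
    also have "\<dots> = ?bound ^ 4"
    proof -
      have X: "T powr (4 * x) = (T powr x) ^ 4" for x
        using T by (simp add: powr_power mult.commute)
      have "root 4 (\<nu> M) ^ 4 = \<nu> M" using \<nu>0 by (intro real_root_pow_pos2) simp_all
      then show ?thesis unfolding X power_mult_distrib power_one_over by simp
    qed
    finally have "?Succ ^ 4 \<le> ?bound ^ 4" .
    then show "?Succ \<le> ?bound"
      using Succ \<epsilon> \<nu>0 by (subst (asm) power_mono_iff) simp_all
  qed
qed

end
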